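(* Let $X$ be a finite graph that is not a complete graph, let $A_X$ be the associated right-angled Artin group, and let $S = V(X)$ be its standard generating set. Then for all integers $k \geq 1$ we have $d_{A_X,S}(k) \geq k$. That is, every nontrivial element $w \in \gamma_k(A_X)$ satisfies $\|w\|_S \geq k$.
   Context: For a finite graph $X$ (simple, undirected) with vertex set $V(X)$, the right-angled Artin group $A_X$ is the group with generating set $V(X)$ and relations $[x,y]=1$ for all $x,y \in V(X)$ joined by an edge. For a group $G$, the lower central series is $\gamma_1(G) = G$ and $\gamma_{k+1}(G) = [\gamma_k(G),G]$ for $k \geq 1$. For a group $G$ with finite generating set $S$ and $g \in G$, the word norm $\|g\|_S$ is the minimal $\ell$ such that $g$ can be written as a word of length $\ell$ in $S^{\pm 1}$. For a non-nilpotent residually nilpotent group $G$ (residually nilpotent means $\bigcap_{k \geq 1}\gamma_k(G) = 1$) with finite generating set $S$, the lower central series depth function is $d_{G,S}(k) = \min\{\|g\|_S \mid g \in \gamma_k(G),\ g \neq 1\}$. Right-angled Artin groups are residually nilpotent, and $A_X$ is nilpotent only if $X$ is a complete graph. *)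

theory Defs
  imports "HOL-Algebra.Generated_Groups" "Graph_Theory.Kuratowski"
begin

section \<open>Groups given by generators and relators\<close>

text \<open>
  A letter \<open>(x, True)\<close> stands for the generator \<open>x\<close> and \<open>(x, False)\<close> for its formal inverse.
\<close>

type_synonym 'a gword = "('a \<times> bool) list"

abbreviation gwords :: "'a set \<Rightarrow> 'a gword set" where
  "gwords V \<equiv> lists (V \<times> UNIV)"

text \<open>
  The congruence on words over \<open>V\<close> generated by free cancellation and by \<open>r = 1\<close> for all
  \<open>r \<in> R\<close>; the set \<open>R\<close> of relators is meant to be a subset of \<^term>\<open>gwords V\<close>.
\<close>

inductive pres_cong :: "'a set \<Rightarrow> 'a gword set \<Rightarrow> 'a gword \<Rightarrow> 'a gword \<Rightarrow> bool"
  for V :: "'a set" and R :: "'a gword set" where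
  refl: "u \<in> gwords V \<Longrightarrow> pres_cong V R u u"
| sym: "pres_cong V R u v \<Longrightarrow> pres_cong V R v u"
| trans: "pres_cong V R u v \<Longrightarrow> pres_cong V R v w \<Longrightarrow> pres_cong V R u w"
| cancel: "u \<in> gwords V \<Longrightarrow> v \<in> gwords V \<Longrightarrow> x \<in> V \<Longrightarrow>
    pres_cong V R (u @ [(x, b), (x, \<not> b)] @ v) (u @ v)"
| relator: "u \<in> gwords V \<Longrightarrow> v \<in> gwords V \<Longrightarrow> r \<in> R \<Longrightarrow>
    pres_cong V R (u @ r @ v) (u @ v)"

definition pres_class :: "'a set \<Rightarrow> 'a gword set \<Rightarrow> 'a gword \<Rightarrow> 'a gword set" where
  "pres_class V R u = {v. pres_cong V R u v}"

definition presented_group :: "'a set \<Rightarrow> 'a gword set \<Rightarrow> 'a gword set monoid" where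
  "presented_group V R =
    \<lparr>carrier = pres_class V R ` gwords V,
     monoid.mult = (\<lambda>A B. \<Union>u\<in>A. \<Union>v\<in>B. pres_class V R (u @ v)),
     monoid.one = pres_class V R []\<rparr>"

lemma pres_cong_gwords:
  assumes "R \<subseteq> gwords V" "pres_cong V R u v"
  shows "u \<in> gwords V" "v \<in> gwords V"
proof -
  have "u \<in> gwords V \<and> v \<in> gwords V"
    using assms(2) by (induction rule: pres_cong.induct) (use assms(1) in auto)
  then show "u \<in> gwords V" "v \<in> gwords V" by auto
qed

lemma pres_cong_context:
  assumes "pres_cong V R u v" "p \<in> gwords V" "q \<in> gwords V"
  shows "pres_cong V R (p @ u @ q) (p @ v @ q)"
  using assms
proof (induction rule: pres_cong.induct)
  case (refl u)
  then show ?case by (intro pres_cong.refl) auto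
next
  case (sym u v)
  then show ?case by (blast intro: pres_cong.sym)
next
  case (trans u v w)
  then show ?case by (blast intro: pres_cong.trans)
next
  case (cancel u v x b)
  then show ?case
    using pres_cong.cancel[of "p @ u" V "v @ q" x R b] by simp
next
  case (relator u v r)
  then show ?case
    using pres_cong.relator[of "p @ u" V "v @ q" r R] by simp
qed

lemma pres_cong_append:
  assumes "R \<subseteq> gwords V" "pres_cong V R u u'" "pres_cong V R v v'"
  shows "pres_cong V R (u @ v) (u' @ v')"
proof -
  have "pres_cong V R (u @ v) (u' @ v)"
    using pres_cong_context[OF assms(2), of "[]" v] pres_cong_gwords[OF assms(1,3)] by simp
  moreover have "pres_cong V R (u' @ v) (u' @ v')"
    using pres_cong_context[OF assms(3), of u' "[]"] pres_cong_gwords[OF assms(1,2)] by simp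
  ultimately show ?thesis by (rule pres_cong.trans)
qed

lemma pres_class_eq_iff:
  assumes "u \<in> gwords V" "v \<in> gwords V"
  shows "pres_class V R u = pres_class V R v \<longleftrightarrow> pres_cong V R u v"
proof
  assume "pres_class V R u = pres_class V R v"
  moreover have "v \<in> pres_class V R v"
    using assms(2) by (simp add: pres_class_def pres_cong.refl)
  ultimately have "v \<in> pres_class V R u" by blast
  then show "pres_cong V R u v" by (simp add: pres_class_def)
next
  assume uv: "pres_cong V R u v"
  show "pres_class V R u = pres_class V R v"
    using pres_cong.trans[OF uv] pres_cong.trans[OF pres_cong.sym[OF uv]]
    by (auto simp: pres_class_def)
qed

lemma carrier_presented_group: "carrier (presented_group V R) = pres_class V R ` gwords V"
  by (simp add: presented_group_def)

lemma one_presented_group: "\<one>\<^bsub>presented_group V R\<^esub> = pres_class V R []"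
  by (simp add: presented_group_def)

lemma mult_presented_group:
  assumes "R \<subseteq> gwords V" "u \<in> gwords V" "v \<in> gwords V"
  shows "pres_class V R u \<otimes>\<^bsub>presented_group V R\<^esub> pres_class V R v = pres_class V R (u @ v)"
proof -
  have *: "pres_class V R (u' @ v') = pres_class V R (u @ v)"
    if "u' \<in> pres_class V R u" "v' \<in> pres_class V R v" for u' v'
  proof -
    have uv: "pres_cong V R (u @ v) (u' @ v')"
      using that by (intro pres_cong_append[OF assms(1)]) (auto simp: pres_class_def)
    then have "u' @ v' \<in> gwords V" by (rule pres_cong_gwords(2)[OF assms(1)])
    moreover have "u @ v \<in> gwords V" using assms by simp
    ultimately show ?thesis
      using uv pres_class_eq_iff[of "u @ v" V "u' @ v'" R] by simp
  qed
  have "u \<in> pres_class V R u" "v \<in> pres_class V R v"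
    using assms by (auto simp: pres_class_def intro: pres_cong.refl)
  then have "(\<Union>u'\<in>pres_class V R u. \<Union>v'\<in>pres_class V R v. pres_class V R (u' @ v'))
      = pres_class V R (u @ v)"
    using * by blast
  then show ?thesis by (simp add: presented_group_def)
qed

lemma pres_cong_inverse:
  assumes "u \<in> gwords V"
  shows "pres_cong V R (map (\<lambda>(x, b). (x, \<not> b)) (rev u) @ u) []"
  using assms
proof (induction u rule: list.induct)
  case Nil
  then show ?case by (auto intro: pres_cong.refl)
next
  case (Cons a u)
  obtain x b where a: "a = (x, b)" by fastforce
  let ?i = "map (\<lambda>(x, b). (x, \<not> b)) (rev u)"
  have u: "u \<in> gwords V" and "x \<in> V"
    using Cons.prems a by simp_all
  have "?i \<in> gwords V"
    using u by (auto simp: in_lists_conv_set)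
  with u \<open>x \<in> V\<close> have "pres_cong V R (?i @ [(x, \<not> b), (x, \<not> \<not> b)] @ u) (?i @ u)"
    by (intro pres_cong.cancel)
  then show ?case
    using pres_cong.trans[OF _ Cons.IH[OF u]] a by simp
qed

lemma group_presented_group:
  assumes R: "R \<subseteq> gwords V"
  shows "group (presented_group V R)"
proof (rule groupI)
  fix x assume "x \<in> carrier (presented_group V R)"
  then obtain u where u: "u \<in> gwords V" "x = pres_class V R u"
    unfolding carrier_presented_group by blast
  let ?i = "map (\<lambda>(x, b). (x, \<not> b)) (rev u)"
  have i: "?i \<in> gwords V" using u by (auto simp: in_lists_conv_set)
  have "pres_class V R ?i \<otimes>\<^bsub>presented_group V R\<^esub> x = \<one>\<^bsub>presented_group V R\<^esub>"
    using u i pres_cong_inverse[OF u(1), of R] pres_class_eq_iff[of "?i @ u" V "[]" R]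
    by (simp add: mult_presented_group[OF R] one_presented_group)
  then show "\<exists>y\<in>carrier (presented_group V R).
      y \<otimes>\<^bsub>presented_group V R\<^esub> x = \<one>\<^bsub>presented_group V R\<^esub>"
    using i by (blast intro: imageI[of ?i "gwords V" "pres_class V R", folded carrier_presented_group])
next
  fix x y assume "x \<in> carrier (presented_group V R)" "y \<in> carrier (presented_group V R)"
  then obtain u v where uv: "u \<in> gwords V" "v \<in> gwords V" "x = pres_class V R u" "y = pres_class V R v"
    unfolding carrier_presented_group by blast
  then have "x \<otimes>\<^bsub>presented_group V R\<^esub> y = pres_class V R (u @ v)"
    by (simp add: mult_presented_group[OF R])
  then show "x \<otimes>\<^bsub>presented_group V R\<^esub> y \<in> carrier (presented_group V R)"
    using uv by (simp add: carrier_presented_group)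
next
  fix x y z
  assume "x \<in> carrier (presented_group V R)" "y \<in> carrier (presented_group V R)"
    "z \<in> carrier (presented_group V R)"
  then obtain u v w where "u \<in> gwords V" "v \<in> gwords V" "w \<in> gwords V"
      "x = pres_class V R u" "y = pres_class V R v" "z = pres_class V R w"
    unfolding carrier_presented_group by blast
  then show "x \<otimes>\<^bsub>presented_group V R\<^esub> y \<otimes>\<^bsub>presented_group V R\<^esub> z
      = x \<otimes>\<^bsub>presented_group V R\<^esub> (y \<otimes>\<^bsub>presented_group V R\<^esub> z)"
    by (simp add: mult_presented_group[OF R])
next
  show "\<one>\<^bsub>presented_group V R\<^esub> \<in> carrier (presented_group V R)"
    by (simp add: carrier_presented_group one_presented_group)
next
  fix x assume "x \<in> carrier (presented_group V R)"
  then obtain u where "u \<in> gwords V" "x = pres_class V R u"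
    unfolding carrier_presented_group by blast
  then show "\<one>\<^bsub>presented_group V R\<^esub> \<otimes>\<^bsub>presented_group V R\<^esub> x = x"
    by (simp add: one_presented_group mult_presented_group[OF R])
qed


section \<open>Right-angled Artin groups\<close>

definition raag_relators :: "('a, 'b) pre_digraph \<Rightarrow> 'a gword set" where
  "raag_relators X =
    {[(x, True), (y, True), (x, False), (y, False)] | x y.
      x \<in> verts X \<and> y \<in> verts X \<and> x \<rightarrow>\<^bsub>X\<^esub> y}"

definition raag :: "('a, 'b) pre_digraph \<Rightarrow> 'a gword set monoid" where
  "raag X = presented_group (verts X) (raag_relators X)"

definition raag_gen :: "('a, 'b) pre_digraph \<Rightarrow> 'a \<Rightarrow> 'a gword set" where
  "raag_gen X x = pres_class (verts X) (raag_relators X) [(x, True)]"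

lemma group_raag: "group (raag X)"
  unfolding raag_def by (rule group_presented_group) (auto simp: raag_relators_def)


section \<open>Lower central series, word norm and depth function\<close>

definition commutator_subgroup :: "('a, 'b) monoid_scheme \<Rightarrow> 'a set \<Rightarrow> 'a set \<Rightarrow> 'a set" where
  "commutator_subgroup G H K =
    generate G (\<Union>h\<in>H. \<Union>k\<in>K. {h \<otimes>\<^bsub>G\<^esub> k \<otimes>\<^bsub>G\<^esub> inv\<^bsub>G\<^esub> h \<otimes>\<^bsub>G\<^esub> inv\<^bsub>G\<^esub> k})"

text \<open>The series starts at index 1; the value at index 0 is a dummy.\<close>

fun lower_central :: "('a, 'b) monoid_scheme \<Rightarrow> nat \<Rightarrow> 'a set" where
  "lower_central G 0 = carrier G"
| "lower_central G (Suc 0) = carrier G"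
| "lower_central G (Suc (Suc k)) =
    commutator_subgroup G (lower_central G (Suc k)) (carrier G)"

definition word_norm :: "('a, 'b) monoid_scheme \<Rightarrow> 'a set \<Rightarrow> 'a \<Rightarrow> nat" where
  "word_norm G S g =
    (LEAST l. \<exists>ws. length ws = l \<and> set ws \<subseteq> S \<union> m_inv G ` S \<and> foldr (monoid.mult G) ws \<one>\<^bsub>G\<^esub> = g)"

text \<open>
  On natural numbers the infimum of a nonempty set is its minimum, whereas the infimum of the
  empty set is 0. A bound \<open>0 < k \<le> lcs_depth G S k\<close> thus includes the assertion that
  \<^term>\<open>lower_central G k\<close> is nontrivial, i.e. that the minimum is well defined.
\<close>

definition lcs_depth :: "('a, 'b) monoid_scheme \<Rightarrow> 'a set \<Rightarrow> nat \<Rightarrow> nat" where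
  "lcs_depth G S k = (INF g\<in>lower_central G k - {\<one>\<^bsub>G\<^esub>}. word_norm G S g)"

end

theory Submission
  imports Defs
begin

text \<open>
  The group acts on the integer-valued functions on words in the vertices that are invariant under
  the commutations of the graph and vanish on all words containing a square \<open>x x\<close>: the generator
  \<open>x\<close> acts as \<open>1 + D\<^sub>x\<close>, where \<open>D\<^sub>x\<close> shifts the argument by \<open>x\<close>. This is the dual of the Magnus
  representation into partially commutative power series modulo the squares of the variables;
  as \<open>D\<^sub>x\<close> has square 0, the power \<open>x\<^sup>e\<close> acts as \<open>1 + e D\<^sub>x\<close>.
  An element of the \<open>k\<close>-th term of the lower central series acts trivially up to terms
  that shift by at least \<open>k\<close> letters. On the other hand a nontrivial element of norm \<open>l\<close> is
  a product of syllables \<open>x\<^sub>1\<^sup>e\<^sup>1 \<dots> x\<^sub>m\<^sup>e\<^sup>m\<close> with \<open>1 \<le> m \<le> l\<close> in which no two syllables can be merged,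
  and then the shift by \<open>x\<^sub>1 \<dots> x\<^sub>m\<close> occurs with coefficient \<open>e\<^sub>1 \<dots> e\<^sub>m \<noteq> 0\<close>. Hence \<open>k \<le> m \<le> l\<close>.

  The terms of the series are nontrivial because two distinct non-adjacent vertices yield
  a surjection onto the infinite dihedral group, which is not nilpotent.
\<close>

section \<open>Actions of presented groups\<close>

lemma (in group) int_pow_commute:
  assumes "x \<otimes> y = y \<otimes> x" "x \<in> carrier G" "y \<in> carrier G"
  shows "x [^] (i :: int) \<otimes> y = y \<otimes> x [^] i"
proof (cases i rule: int_cases)
  case (nonneg n)
  then show ?thesis
    using assms by (simp add: int_pow_int group_commutes_pow)
next
  case (neg n)
  have "y \<otimes> inv a = inv a \<otimes> y" if "a \<otimes> y = y \<otimes> a" "a \<in> carrier G" for a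
  proof -
    have "a \<otimes> (y \<otimes> inv a) = y \<otimes> (a \<otimes> inv a)"
      using that assms(3) by (metis inv_closed m_assoc)
    then show ?thesis
      using that assms(3) by (subst inv_solve_left) simp_all
  qed
  from this[OF group_commutes_pow[OF assms, of "Suc n"]]
  have "y \<otimes> inv (x [^] Suc n) = inv (x [^] Suc n) \<otimes> y"
    using assms(2) by simp
  then show ?thesis
    unfolding neg using assms by (simp add: int_pow_neg_int del: nat_pow_Suc of_nat_Suc)
qed

text \<open>Von Dyck's principle, instantiated twice below: by the Magnus action and by a dihedral
  action on the integers. A carrier set \<open>M\<close> is kept because shears cancel only on
  functions that vanish on squares. Since \<open>letter_cancel\<close> covers both values of
  \<open>b\<close>, each letter permutes \<open>M\<close>.\<close>

locale presentation_action =
  fixes V :: "'a set" and R :: "'a gword set"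
    and \<phi> :: "'a \<times> bool \<Rightarrow> 's \<Rightarrow> 's" and M :: "'s set"
  assumes relators: "R \<subseteq> gwords V"
    and letter_closed: "\<And>x b f. x \<in> V \<Longrightarrow> f \<in> M \<Longrightarrow> \<phi> (x, b) f \<in> M"
    and letter_cancel: "\<And>x b f. x \<in> V \<Longrightarrow> f \<in> M \<Longrightarrow> \<phi> (x, b) (\<phi> (x, \<not> b) f) = f"
    and relator_act: "\<And>r f. r \<in> R \<Longrightarrow> f \<in> M \<Longrightarrow> foldr \<phi> r f = f"
begin

abbreviation "PG \<equiv> presented_group V R"

sublocale PG: group PG
  by (rule group_presented_group[OF relators])

text \<open>The choice of representative is harmless by \<open>foldr_pres_cong\<close>. With
  \<open>foldr\<close> the last letter acts first, which gives a left action.\<close>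

definition act :: "'a gword set \<Rightarrow> 's \<Rightarrow> 's" where
  "act g f = foldr \<phi> (SOME u. u \<in> g) f"

lemma foldr_closed:
  assumes "u \<in> gwords V" "f \<in> M"
  shows "foldr \<phi> u f \<in> M"
  using assms(1)
proof (induction u rule: list.induct)
  case (Cons c u)
  then show ?case
    by (cases c) (auto intro: letter_closed)
qed (simp add: assms(2))

lemma foldr_pres_cong:
  assumes "pres_cong V R u v" "f \<in> M"
  shows "foldr \<phi> u f = foldr \<phi> v f"
  using assms
proof (induction arbitrary: f rule: pres_cong.induct)
  case (cancel u v x b)
  then show ?case
    using foldr_closed[of v f] by (simp add: letter_cancel)
next
  case (relator u v r)
  then show ?case
    using foldr_closed[of v f] by (simp add: relator_act)
qed auto

lemma act_class:
  assumes "u \<in> gwords V" "f \<in> M"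
  shows "act (pres_class V R u) f = foldr \<phi> u f"
proof -
  have "u \<in> pres_class V R u"
    using assms(1) by (simp add: pres_class_def pres_cong.refl)
  then have "(SOME u'. u' \<in> pres_class V R u) \<in> pres_class V R u"
    by (rule someI)
  then show ?thesis
    using foldr_pres_cong assms(2) by (simp add: act_def pres_class_def)
qed

lemma carrier_classE:
  assumes "g \<in> carrier PG"
  obtains u where "u \<in> gwords V" "g = pres_class V R u"
  using assms unfolding carrier_presented_group by blast

lemma act_one: "f \<in> M \<Longrightarrow> act \<one>\<^bsub>PG\<^esub> f = f"
  by (simp add: one_presented_group act_class)

lemma act_mult:
  "g \<in> carrier PG \<Longrightarrow> h \<in> carrier PG \<Longrightarrow> f \<in> M \<Longrightarrow> act (g \<otimes>\<^bsub>PG\<^esub> h) f = act g (act h f)"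
  by (elim carrier_classE)
    (simp add: mult_presented_group[OF relators] act_class foldr_closed del: in_lists_conv_set)

lemma act_inv:
  assumes "g \<in> carrier PG" "f \<in> M"
  shows "act g (act (inv\<^bsub>PG\<^esub> g) f) = f"
  using assms by (simp flip: act_mult add: act_one)

lemma letter_class_closed: "x \<in> V \<Longrightarrow> pres_class V R [(x, b)] \<in> carrier PG"
  by (auto simp: carrier_presented_group)

lemma act_letter:
  "x \<in> V \<Longrightarrow> f \<in> M \<Longrightarrow> act (pres_class V R [(x, b)]) f = \<phi> (x, b) f"
  by (simp add: act_class)

lemma inv_letter:
  assumes "x \<in> V"
  shows "inv\<^bsub>PG\<^esub> (pres_class V R [(x, True)]) = pres_class V R [(x, False)]"
proof (rule PG.inv_equality)
  have "pres_cong V R ([] @ [(x, False), (x, \<not> False)] @ []) ([] @ [])"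
    using assms by (intro pres_cong.cancel) auto
  then show "pres_class V R [(x, False)] \<otimes>\<^bsub>PG\<^esub> pres_class V R [(x, True)] = \<one>\<^bsub>PG\<^esub>"
    using assms
    by (simp add: mult_presented_group[OF relators] one_presented_group pres_class_eq_iff)
qed (use assms letter_class_closed in auto)

lemma class_eq_foldr:
  assumes "u \<in> gwords V"
  shows "pres_class V R u =
    foldr (monoid.mult PG) (map (\<lambda>c. pres_class V R [c]) u) \<one>\<^bsub>PG\<^esub>"
  using assms
proof (induction u rule: list.induct)
  case (Cons c u)
  then have "pres_class V R (c # u) = pres_class V R [c] \<otimes>\<^bsub>PG\<^esub> pres_class V R u"
    by (subst mult_presented_group[OF relators]) auto
  with Cons show ?case by simp
qed (simp add: one_presented_group)

end


section \<open>Words up to commutation\<close>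

inductive swap :: "('a \<Rightarrow> 'a \<Rightarrow> bool) \<Rightarrow> 'a list \<Rightarrow> 'a list \<Rightarrow> bool" for E where
  "E x y \<Longrightarrow> swap E (u @ [x, y] @ v) (u @ [y, x] @ v)"

text \<open>All letters before the first \<open>x\<close> are neighbours of \<open>x\<close>, so
  that commutations can bring this \<open>x\<close> to the front.\<close>

fun can_lead :: "('a \<Rightarrow> 'a \<Rightarrow> bool) \<Rightarrow> 'a \<Rightarrow> 'a list \<Rightarrow> bool" where
  "can_lead E x [] = False"
| "can_lead E x (y # w) = (y = x \<or> E x y \<and> can_lead E x w)"

text \<open>No word equivalent to \<open>w\<close> up to commutation contains a square \<open>x x\<close>.\<close>

fun square_free :: "('a \<Rightarrow> 'a \<Rightarrow> bool) \<Rightarrow> 'a list \<Rightarrow> bool" where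
  "square_free E [] = True"
| "square_free E (x # w) = (square_free E w \<and> \<not> can_lead E x w)"

lemma can_lead_swap:
  assumes "symp E" "swap E v w"
  shows "can_lead E x v = can_lead E x w"
  using assms(2)
proof cases
  case (1 y z p q)
  have "can_lead E x (p @ [y, z] @ q) = can_lead E x (p @ [z, y] @ q)"
    using 1(3) sympD[OF assms(1)] by (induction p) auto
  then show ?thesis using 1 by simp
qed

text \<open>At the swapped pair, irreflexivity makes the two letters distinct, so each is merely
  passed over when the other is tested by \<open>can_lead\<close>. In front of the pair,
  \<open>can_lead_swap\<close> applies.\<close>

lemma square_free_swap:
  assumes "symp E" "irreflp E" "swap E v w"
  shows "square_free E v = square_free E w"
  using assms(3)
proof cases
  case (1 y z p q)
  have "square_free E (p @ [y, z] @ q) = square_free E (p @ [z, y] @ q)"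
  proof (induction p)
    case Nil
    have "y \<noteq> z" "E z y"
      using 1(3) assms by (auto simp: irreflp_def dest: sympD)
    then show ?case using 1(3) by auto
  next
    case (Cons x p)
    have "swap E (p @ [y, z] @ q) (p @ [z, y] @ q)"
      using 1(3) by (rule swap.intros)
    with Cons show ?case using can_lead_swap[OF assms(1)] by fastforce
  qed
  then show ?thesis using 1 by simp
qed

lemma square_free_swaps:
  assumes "symp E" "irreflp E" "(swap E)\<^sup>*\<^sup>* v w"
  shows "square_free E v = square_free E w"
  using assms(3) by (induction) (auto dest: square_free_swap[OF assms(1,2)])

lemma not_square_free_append: "\<not> square_free E (u @ [x, x] @ v)"
  by (induction u) auto

lemma length_swaps: "(swap E)\<^sup>*\<^sup>* v w \<Longrightarrow> length v = length w"
  by (induction rule: rtranclp_induct) (auto elim!: swap.cases)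


section \<open>Functions on square-free traces\<close>

text \<open>Dual of the partially commutative power series modulo squares, truncated at degree
  \<open>n\<close>. The bound \<open>n\<close> on the support supplies the filtration in which depth
  is measured; for \<open>n = 0\<close> only the zero function is left.\<close>

definition trace_funs :: "('a \<Rightarrow> 'a \<Rightarrow> bool) \<Rightarrow> nat \<Rightarrow> ('a list \<Rightarrow> int) set" where
  "trace_funs E n = {f.
     (\<forall>u x y v. E x y \<longrightarrow> f (u @ [x, y] @ v) = f (u @ [y, x] @ v)) \<and>
     (\<forall>u x v. f (u @ [x, x] @ v) = 0) \<and>
     (\<forall>w. n \<le> length w \<longrightarrow> f w = 0)}"

text \<open>The letter is appended at the end so that composed shears read off syllables from left
  to right: \<open>shear d x (shear e y f)\<close> at \<open>w\<close> has the term
  \<open>d * e * f (w @ [x, y])\<close>.\<close>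

definition shear :: "int \<Rightarrow> 'a \<Rightarrow> ('a list \<Rightarrow> int) \<Rightarrow> 'a list \<Rightarrow> int" where
  "shear e x f = (\<lambda>w. f w + e * f (w @ [x]))"

lemma trace_funsI:
  assumes "\<And>u x y v. E x y \<Longrightarrow> f (u @ x # y # v) = f (u @ y # x # v)"
    and "\<And>u x v. f (u @ x # x # v) = 0"
    and "\<And>w. n \<le> length w \<Longrightarrow> f w = 0"
  shows "f \<in> trace_funs E n"
  unfolding trace_funs_def using assms by auto

lemma
  assumes "f \<in> trace_funs E n"
  shows trace_funs_swap: "E x y \<Longrightarrow> f (u @ x # y # v) = f (u @ y # x # v)"
    and trace_funs_square: "f (u @ x # x # v) = 0"
    and trace_funs_length: "n \<le> length w \<Longrightarrow> f w = 0"
proof -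
  have "\<forall>u x y v. E x y \<longrightarrow> f (u @ [x, y] @ v) = f (u @ [y, x] @ v)"
    using assms unfolding trace_funs_def by blast
  from this[rule_format, of x y u v]
  show "E x y \<Longrightarrow> f (u @ x # y # v) = f (u @ y # x # v)" by simp
  have "\<forall>u x v. f (u @ [x, x] @ v) = 0"
    using assms unfolding trace_funs_def by blast
  from this[rule_format, of u x v]
  show "f (u @ x # x # v) = 0" by simp
  show "n \<le> length w \<Longrightarrow> f w = 0"
    using assms unfolding trace_funs_def by blast
qed

lemma trace_funs_add:
  assumes f: "f \<in> trace_funs E n" and g: "g \<in> trace_funs E n"
  shows "(\<lambda>w. f w + g w) \<in> trace_funs E n"
proof (rule trace_funsI)
  show "f (u @ x # y # v) + g (u @ x # y # v) = f (u @ y # x # v) + g (u @ y # x # v)"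
    if "E x y" for u x y v
    using trace_funs_swap[OF f that, of u v] trace_funs_swap[OF g that, of u v] by simp
qed (simp_all add: trace_funs_square[OF f] trace_funs_square[OF g]
    trace_funs_length[OF f] trace_funs_length[OF g])

lemma trace_funs_diff:
  assumes f: "f \<in> trace_funs E n" and g: "g \<in> trace_funs E n"
  shows "(\<lambda>w. f w - g w) \<in> trace_funs E n"
proof (rule trace_funsI)
  show "f (u @ x # y # v) - g (u @ x # y # v) = f (u @ y # x # v) - g (u @ y # x # v)"
    if "E x y" for u x y v
    using trace_funs_swap[OF f that, of u v] trace_funs_swap[OF g that, of u v] by simp
qed (simp_all add: trace_funs_square[OF f] trace_funs_square[OF g]
    trace_funs_length[OF f] trace_funs_length[OF g])

lemma trace_funs_zero: "(\<lambda>w. 0) \<in> trace_funs E n"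
  by (rule trace_funsI) simp_all

lemma trace_funs_mono:
  assumes f: "f \<in> trace_funs E m" and "m \<le> n"
  shows "f \<in> trace_funs E n"
proof (rule trace_funsI)
  show "f (u @ x # y # v) = f (u @ y # x # v)" if "E x y" for u x y v
    using f that by (rule trace_funs_swap)
qed (use assms in \<open>simp_all add: trace_funs_square[OF f] trace_funs_length[OF f]\<close>)

text \<open>The shifted function at \<open>w\<close> looks at a word one letter longer, so its
  support bound drops by one. This is the only source of depth in the whole argument.\<close>

lemma trace_funs_shift:
  assumes f: "f \<in> trace_funs E n"
  shows "(\<lambda>w. e * f (w @ [x])) \<in> trace_funs E (n - 1)"
proof (rule trace_funsI)
  show "e * f ((u @ y # z # v) @ [x]) = e * f ((u @ z # y # v) @ [x])" if "E y z" for u y z v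
    using trace_funs_swap[OF f that, of u "v @ [x]"] by simp
  show "e * f ((u @ y # y # v) @ [x]) = 0" for u y v
    using trace_funs_square[OF f, of u y "v @ [x]"] by simp
  show "e * f (w @ [x]) = 0" if "n - 1 \<le> length w" for w
    using trace_funs_length[OF f, of "w @ [x]"] that by simp
qed

lemma shear_trace_funs:
  assumes "f \<in> trace_funs E n"
  shows "shear e x f \<in> trace_funs E n"
  unfolding shear_def
  using trace_funs_add[OF assms trace_funs_mono[OF trace_funs_shift[OF assms]]] by simp

text \<open>The cross term \<open>d * e * f (w @ [x, x])\<close> vanishes, as the shift by
  \<open>x\<close> has square zero.\<close>

lemma shear_shear:
  assumes "f \<in> trace_funs E n"
  shows "shear d x (shear e x f) = shear (d + e) x f"
  using trace_funs_square[OF assms, of _ x "[]"] by (simp add: shear_def algebra_simps)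

lemma shear_0: "shear 0 x f = f"
  by (simp add: shear_def)

lemma shear_commute:
  assumes "f \<in> trace_funs E n" "E x y"
  shows "shear d x (shear e y f) = shear e y (shear d x f)"
  using trace_funs_swap[OF assms, of _ "[]"] by (simp add: shear_def algebra_simps)

lemma shear_diff: "shear e x (\<lambda>w. f w - g w) = (\<lambda>w. shear e x f w - shear e x g w)"
  by (simp add: shear_def algebra_simps)

text \<open>The dual basis vector of the monomial \<open>u\<close>. For symmetric \<open>E\<close>
  the closure of \<open>swap E\<close> is already an equivalence relation.\<close>

definition trace_indicator :: "('a \<Rightarrow> 'a \<Rightarrow> bool) \<Rightarrow> 'a list \<Rightarrow> 'a list \<Rightarrow> int" where
  "trace_indicator E u w = (if (swap E)\<^sup>*\<^sup>* u w then 1 else 0)"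

text \<open>Square-freeness is invariant under commutation, so the class of \<open>u\<close>
  contains no word with a square and the indicator vanishes on all such words.\<close>

lemma trace_indicator_in_trace_funs:
  assumes "symp E" "irreflp E" "square_free E u"
  shows "trace_indicator E u \<in> trace_funs E (Suc (length u))"
proof (rule trace_funsI)
  have step: "(swap E)\<^sup>*\<^sup>* u (p @ y # x # q)" if "(swap E)\<^sup>*\<^sup>* u (p @ x # y # q)" "E x y" for p x y q
    using that(1) swap.intros[of E x y p q, OF that(2)] by simp
  show "trace_indicator E u (p @ x # y # q) = trace_indicator E u (p @ y # x # q)"
    if "E x y" for p x y q
    using step[of p x y q] step[of p y x q] that sympD[OF assms(1) that]
    unfolding trace_indicator_def by auto
  show "trace_indicator E u (p @ x # x # q) = 0" for p x q
    using square_free_swaps[OF assms(1,2), of u "p @ x # x # q"] assms(3)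
      not_square_free_append[of E p x q]
    unfolding trace_indicator_def by auto
  show "trace_indicator E u w = 0" if "Suc (length u) \<le> length w" for w
    using that length_swaps[of E u w] unfolding trace_indicator_def by auto
qed

text \<open>Expanding the product, a term reaches the length \<open>l\<close> on which
  \<open>f\<close> lives only if every syllable contributes its shift. The inequality in the
  premise, instead of an equation, lets the induction treat the unshifted summand too.\<close>

lemma foldr_shear_eq_prod:
  assumes "\<And>w. length w \<noteq> l \<Longrightarrow> f w = 0" "length w + length s \<le> l"
  shows "foldr (\<lambda>(x, e). shear e x) s f w =
    (if length w + length s = l then prod_list (map snd s) * f (w @ map fst s) else 0)"
  using assms(2)
proof (induction s arbitrary: w)
  case (Cons c s)
  then show ?case by (auto simp: shear_def split: prod.splits)
qed (use assms(1) in auto)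


section \<open>The Magnus action of a right-angled Artin group\<close>

abbreviation letter_shear :: "'a \<times> bool \<Rightarrow> ('a list \<Rightarrow> int) \<Rightarrow> 'a list \<Rightarrow> int" where
  "letter_shear \<equiv> \<lambda>(x, b). shear (if b then 1 else - 1) x"

context graph
begin

abbreviation adj :: "'a \<Rightarrow> 'a \<Rightarrow> bool" where
  "adj x y \<equiv> x \<rightarrow>\<^bsub>G\<^esub> y"

lemma symp_adj: "symp adj"
  using sym_arcs unfolding symmetric_def by (auto intro!: sympI dest: symD)

lemma irreflp_adj: "irreflp adj"
  by (auto intro!: irreflpI simp: arcs_ends_conv dest: no_loops)

sublocale magnus: presentation_action "verts G" "raag_relators G" letter_shear "\<Union>n. trace_funs adj n"
proof
  show "raag_relators G \<subseteq> gwords (verts G)"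
    by (auto simp: raag_relators_def)
next
  fix r f
  assume r: "r \<in> raag_relators G" and "f \<in> (\<Union>n. trace_funs adj n)"
  then obtain n where f: "f \<in> trace_funs adj n" by blast
  from r obtain x y where r: "r = [(x, True), (y, True), (x, False), (y, False)]" and E: "adj x y"
    by (auto simp: raag_relators_def)
  \<comment> \<open>Moving \<open>y\<close> past the inverse of \<open>x\<close> leaves two
    cancelling pairs.\<close>
  let ?f = "shear (- 1) y f"
  have "shear 1 y (shear (- 1) x ?f) = shear (- 1) x (shear 1 y ?f)"
    using E shear_trace_funs[OF f] by (simp add: shear_commute[of _ adj n])
  also have "shear 1 y ?f = f"
    by (simp add: shear_shear[OF f] shear_0)
  finally show "foldr letter_shear r f = f"
    by (simp add: r shear_shear[OF f] shear_0)
qed (auto simp: shear_shear shear_0 intro: shear_trace_funs)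

lemma magnus_group: "magnus.PG = raag G"
  by (simp add: raag_def)

sublocale A: group "raag G"
  by (rule group_raag)

lemma
  assumes "f \<in> trace_funs adj n"
  shows act_raag_one: "magnus.act \<one>\<^bsub>raag G\<^esub> f = f"
    and act_raag_mult: "g \<in> carrier (raag G) \<Longrightarrow> h \<in> carrier (raag G) \<Longrightarrow>
      magnus.act (g \<otimes>\<^bsub>raag G\<^esub> h) f = magnus.act g (magnus.act h f)"
    and act_raag_inv: "g \<in> carrier (raag G) \<Longrightarrow>
      magnus.act g (magnus.act (inv\<^bsub>raag G\<^esub> g) f) = f"
    and act_raag_class: "u \<in> gwords (verts G) \<Longrightarrow>
      magnus.act (pres_class (verts G) (raag_relators G) u) f = foldr letter_shear u f"
  using assms magnus.act_one[of f, unfolded magnus_group] magnus.act_mult[of g h f, unfolded magnus_group]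
    magnus.act_inv[of g f, unfolded magnus_group] magnus.act_class[of u f]
  by blast+

lemmas act_simps = act_raag_one act_raag_mult act_raag_inv act_raag_class

lemma raag_gen_closed: "x \<in> verts G \<Longrightarrow> raag_gen G x \<in> carrier (raag G)"
  using magnus.letter_class_closed unfolding magnus_group raag_gen_def .

lemma foldr_letter_shear_trace_funs:
  "f \<in> trace_funs adj n \<Longrightarrow> foldr letter_shear u f \<in> trace_funs adj n"
  by (induction u) (auto intro: shear_trace_funs)

lemma act_trace_funs:
  assumes "g \<in> carrier (raag G)" "f \<in> trace_funs adj n"
  shows "magnus.act g f \<in> trace_funs adj n"
proof -
  obtain u where "u \<in> gwords (verts G)" "g = pres_class (verts G) (raag_relators G) u"
    using assms(1) magnus.carrier_classE unfolding magnus_group by blast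
  then show ?thesis
    using assms(2) by (simp add: act_simps foldr_letter_shear_trace_funs del: in_lists_conv_set)
qed

lemma act_diff:
  assumes "g \<in> carrier (raag G)" "f \<in> trace_funs adj n" "h \<in> trace_funs adj n"
  shows "magnus.act g (\<lambda>w. f w - h w) = (\<lambda>w. magnus.act g f w - magnus.act g h w)"
proof -
  obtain u where u: "u \<in> gwords (verts G)" "g = pres_class (verts G) (raag_relators G) u"
    using assms(1) magnus.carrier_classE unfolding magnus_group by blast
  have "foldr letter_shear u (\<lambda>w. f w - h w) =
      (\<lambda>w. foldr letter_shear u f w - foldr letter_shear u h w)"
    by (induction u) (auto simp: shear_diff)
  moreover have "(\<lambda>w. f w - h w) \<in> trace_funs adj n"
    using assms by (intro trace_funs_diff)
  ultimately show ?thesis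
    using u assms by (simp add: act_simps del: in_lists_conv_set)
qed

section \<open>The filtration of the group by Magnus depth\<close>

text \<open>Dually, the Magnus expansion of \<open>g\<close> is 1 plus terms of degree at least
  \<open>k\<close>: the operator \<open>g - 1\<close> lowers the support bound by
  \<open>k\<close>.\<close>

definition magnus_depth :: "nat \<Rightarrow> 'a gword set set" where
  "magnus_depth k = {g \<in> carrier (raag G).
     \<forall>n. \<forall>f\<in>trace_funs adj n. (\<lambda>w. magnus.act g f w - f w) \<in> trace_funs adj (n - k)}"

lemma magnus_depth_closed: "g \<in> magnus_depth k \<Longrightarrow> g \<in> carrier (raag G)"
  by (simp add: magnus_depth_def)

lemma magnus_depthD:
  "g \<in> magnus_depth k \<Longrightarrow> f \<in> trace_funs adj n \<Longrightarrow>
    (\<lambda>w. magnus.act g f w - f w) \<in> trace_funs adj (n - k)"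
  by (simp add: magnus_depth_def)

text \<open>As operators, \<open>g h - 1 = (g - 1) h + (h - 1)\<close> and
  \<open>g^-1 - 1 = - (g - 1) g^-1\<close>, while the action itself preserves each
  \<open>trace_funs adj n\<close>.\<close>

lemma subgroup_magnus_depth: "subgroup (magnus_depth k) (raag G)"
proof (rule A.subgroupI)
  show "magnus_depth k \<subseteq> carrier (raag G)"
    by (auto dest: magnus_depth_closed)
  have "\<one>\<^bsub>raag G\<^esub> \<in> magnus_depth k"
    by (simp add: magnus_depth_def act_simps trace_funs_zero)
  then show "magnus_depth k \<noteq> {}" by blast
next
  fix g assume g: "g \<in> magnus_depth k"
  have c: "g \<in> carrier (raag G)" using g by (rule magnus_depth_closed)
  show "inv\<^bsub>raag G\<^esub> g \<in> magnus_depth k"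
    unfolding magnus_depth_def
  proof (intro CollectI conjI allI ballI)
    fix n f assume f: "f \<in> trace_funs adj n"
    let ?f = "magnus.act (inv\<^bsub>raag G\<^esub> g) f"
    have "?f \<in> trace_funs adj n"
      using c f by (intro act_trace_funs) auto
    from magnus_depthD[OF g this] have "(\<lambda>w. f w - ?f w) \<in> trace_funs adj (n - k)"
      using c f by (simp add: act_simps)
    from trace_funs_diff[OF trace_funs_zero this] show "(\<lambda>w. ?f w - f w) \<in> trace_funs adj (n - k)"
      by simp
  qed (use c in simp)
next
  fix g h assume gh: "g \<in> magnus_depth k" "h \<in> magnus_depth k"
  have c: "g \<in> carrier (raag G)" "h \<in> carrier (raag G)"
    using gh by (auto dest: magnus_depth_closed)
  show "g \<otimes>\<^bsub>raag G\<^esub> h \<in> magnus_depth k"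
    unfolding magnus_depth_def
  proof (intro CollectI conjI allI ballI)
    fix n f assume f: "f \<in> trace_funs adj n"
    have "magnus.act h f \<in> trace_funs adj n"
      using c f by (intro act_trace_funs)
    from trace_funs_add[OF magnus_depthD[OF gh(1) this] magnus_depthD[OF gh(2) f]]
    show "(\<lambda>w. magnus.act (g \<otimes>\<^bsub>raag G\<^esub> h) f w - f w) \<in> trace_funs adj (n - k)"
      using c f by (simp add: act_simps)
  qed (use c in simp)
qed

text \<open>Prepending a letter to a word \<open>u\<close> changes the action by plus or minus one
  shift of the function \<open>u f\<close>, and a shift lowers the bound by one.\<close>

lemma carrier_magnus_depth: "carrier (raag G) = magnus_depth 1"
proof
  show "carrier (raag G) \<subseteq> magnus_depth 1"
  proof
    fix g assume g: "g \<in> carrier (raag G)"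
    then obtain u where u: "u \<in> gwords (verts G)" "g = pres_class (verts G) (raag_relators G) u"
      using magnus.carrier_classE unfolding magnus_group by blast
    have "(\<lambda>w. foldr letter_shear u f w - f w) \<in> trace_funs adj (n - 1)"
      if f: "f \<in> trace_funs adj n" for f n
    proof (induction u)
      case (Cons c u)
      obtain x b where c: "c = (x, b)" by fastforce
      have "(\<lambda>w. (if b then 1 else - 1) * foldr letter_shear u f (w @ [x])) \<in> trace_funs adj (n - 1)"
        by (rule trace_funs_shift) (rule foldr_letter_shear_trace_funs[OF f])
      from trace_funs_add[OF Cons this] show ?case
        by (cases b) (simp_all add: c shear_def[of _ x "foldr letter_shear u f"] algebra_simps)
    qed (simp add: trace_funs_zero)
    then show "g \<in> magnus_depth 1"
      using g u by (auto simp: magnus_depth_def act_raag_class simp del: in_lists_conv_set)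
  qed
qed (auto dest: magnus_depth_closed)

text \<open>The commutator minus 1 equals
  \<open>((g - 1) (h - 1) - (h - 1) (g - 1)) g^-1 h^-1\<close>. Each of the two products lowers the
  bound by \<open>k + 1\<close>.\<close>

lemma commutator_magnus_depth:
  assumes "g \<in> magnus_depth k" "h \<in> magnus_depth 1"
  shows "g \<otimes>\<^bsub>raag G\<^esub> h \<otimes>\<^bsub>raag G\<^esub> inv\<^bsub>raag G\<^esub> g \<otimes>\<^bsub>raag G\<^esub> inv\<^bsub>raag G\<^esub> h \<in> magnus_depth (Suc k)"
    (is "?c \<in> _")
  unfolding magnus_depth_def
proof (intro CollectI conjI allI ballI)
  have c: "g \<in> carrier (raag G)" "h \<in> carrier (raag G)"
    using assms by (auto dest: magnus_depth_closed)
  then show "?c \<in> carrier (raag G)" by simp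
  fix n f assume f: "f \<in> trace_funs adj n"
  let ?f = "magnus.act (inv\<^bsub>raag G\<^esub> g \<otimes>\<^bsub>raag G\<^esub> inv\<^bsub>raag G\<^esub> h) f"
  let ?a = "\<lambda>f w. magnus.act g f w - f w" and ?b = "\<lambda>f w. magnus.act h f w - f w"
  have f': "?f \<in> trace_funs adj n"
    using c f by (intro act_trace_funs) auto
  have ghf: "magnus.act g ?f \<in> trace_funs adj n" "magnus.act h ?f \<in> trace_funs adj n"
    using c f' by (auto intro: act_trace_funs)
  have "?a (?b ?f) \<in> trace_funs adj (n - 1 - k)"
    using assms f' by (intro magnus_depthD)
  then have ab: "?a (?b ?f) \<in> trace_funs adj (n - Suc k)"
    by simp
  have "?b (?a ?f) \<in> trace_funs adj (n - k - 1)"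
    using assms f' by (intro magnus_depthD)
  then have ba: "?b (?a ?f) \<in> trace_funs adj (n - Suc k)"
    by simp
  have "(\<lambda>w. ?a (?b ?f) w - ?b (?a ?f) w) \<in> trace_funs adj (n - Suc k)"
    by (rule trace_funs_diff[OF ab ba])
  moreover have "?a (?b ?f) w - ?b (?a ?f) w = magnus.act g (magnus.act h ?f) w - magnus.act h (magnus.act g ?f) w" for w
    using c f' ghf by (simp add: act_diff)
  moreover have "magnus.act g (magnus.act h ?f) = magnus.act ?c f"
  proof -
    have "?c = g \<otimes>\<^bsub>raag G\<^esub> (h \<otimes>\<^bsub>raag G\<^esub> (inv\<^bsub>raag G\<^esub> g \<otimes>\<^bsub>raag G\<^esub> inv\<^bsub>raag G\<^esub> h))"
      using c by (simp add: A.m_assoc)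
    then show ?thesis
      using c f f' ghf by (simp add: act_simps(2))
  qed
  moreover have "magnus.act h (magnus.act g ?f) = f"
  proof -
    have "magnus.act (inv\<^bsub>raag G\<^esub> h) f \<in> trace_funs adj n"
      using c f by (intro act_trace_funs) auto
    then show ?thesis
      using c f by (simp add: act_simps)
  qed
  ultimately show "(\<lambda>w. magnus.act ?c f w - f w) \<in> trace_funs adj (n - Suc k)"
    by simp
qed

lemma lower_central_subset_magnus_depth: "lower_central (raag G) (Suc k) \<subseteq> magnus_depth (Suc k)"
proof (induction k)
  case 0
  then show ?case by (simp add: carrier_magnus_depth)
next
  case (Suc k)
  then show ?case
    unfolding lower_central.simps commutator_subgroup_def
    by (intro A.generate_subgroup_incl subgroup_magnus_depth)
      (auto intro: commutator_magnus_depth simp: carrier_magnus_depth)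
qed


section \<open>Syllable normal forms\<close>

definition syllables :: "('a \<times> int) list \<Rightarrow> 'a gword set" where
  "syllables s =
    foldr (\<lambda>(x, e) g. (raag_gen G x [^]\<^bsub>raag G\<^esub> e) \<otimes>\<^bsub>raag G\<^esub> g) s \<one>\<^bsub>raag G\<^esub>"

lemma syllables_Nil: "syllables [] = \<one>\<^bsub>raag G\<^esub>"
  by (simp add: syllables_def)

lemma syllables_Cons:
  "syllables ((x, e) # s) = (raag_gen G x [^]\<^bsub>raag G\<^esub> e) \<otimes>\<^bsub>raag G\<^esub> syllables s"
  by (simp add: syllables_def)

lemma syllables_closed: "fst ` set s \<subseteq> verts G \<Longrightarrow> syllables s \<in> carrier (raag G)"
  by (induction s) (auto simp: syllables_Nil syllables_Cons raag_gen_closed A.int_pow_closed)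

lemma act_raag_gen_power:
  assumes x: "x \<in> verts G" and f: "f \<in> trace_funs adj n"
  shows "magnus.act (raag_gen G x [^]\<^bsub>raag G\<^esub> (e :: int)) f = shear e x f"
  using f
proof (induction e arbitrary: f rule: int_induct[where k = 0])
  case base
  then show ?case by (simp add: act_simps shear_0)
next
  case (step1 i)
  have "magnus.act (raag_gen G x) f = shear 1 x f"
    using magnus.act_letter[OF x, of f True] step1.prems by (auto simp: raag_gen_def)
  moreover have "shear 1 x f \<in> trace_funs adj n"
    using step1.prems by (rule shear_trace_funs)
  ultimately show ?case
    using step1 x raag_gen_closed[OF x]
    by (simp add: act_simps A.int_pow_mult shear_shear[of _ adj n])
next
  case (step2 i)
  have "magnus.act (inv\<^bsub>raag G\<^esub> raag_gen G x) f = shear (- 1) x f"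
    using magnus.act_letter[OF x, of f False] step2.prems
    by (auto simp: raag_gen_def magnus.inv_letter[OF x, unfolded magnus_group])
  moreover have "shear (- 1) x f \<in> trace_funs adj n"
    using step2.prems by (rule shear_trace_funs)
  moreover have "raag_gen G x [^]\<^bsub>raag G\<^esub> (i - 1) =
      raag_gen G x [^]\<^bsub>raag G\<^esub> i \<otimes>\<^bsub>raag G\<^esub> inv\<^bsub>raag G\<^esub> raag_gen G x"
    using raag_gen_closed[OF x] A.int_pow_mult[of "raag_gen G x" i "- 1"]
    by (simp add: A.int_pow_neg)
  ultimately show ?case
    using step2 x raag_gen_closed[OF x]
    by (simp add: act_simps shear_shear[of _ adj n])
qed

lemma act_syllables:
  assumes "fst ` set s \<subseteq> verts G" "f \<in> trace_funs adj n"
  shows "magnus.act (syllables s) f = foldr (\<lambda>(x, e). shear e x) s f"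
  using assms(1)
proof (induction s)
  case Nil
  then show ?case
    using assms(2) by (simp add: syllables_Nil act_simps)
next
  case (Cons c s)
  obtain x e where c: "c = (x, e)" by fastforce
  then have s: "x \<in> verts G" "syllables s \<in> carrier (raag G)"
    using Cons.prems by (auto intro: syllables_closed)
  then have "magnus.act (syllables s) f \<in> trace_funs adj n"
    using assms(2) by (intro act_trace_funs)
  then show ?case
    using Cons s c assms(2) raag_gen_closed[OF s(1)]
    by (simp add: syllables_Cons act_simps act_raag_gen_power)
qed

lemma raag_gen_commute:
  assumes "adj x y"
  shows "raag_gen G x \<otimes>\<^bsub>raag G\<^esub> raag_gen G y = raag_gen G y \<otimes>\<^bsub>raag G\<^esub> raag_gen G x"
proof -
  have xy: "x \<in> verts G" "y \<in> verts G"
    using assms by (auto simp: arcs_ends_conv)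
  let ?c = "\<lambda>u. pres_class (verts G) (raag_relators G) u"
  have "[(x, True), (y, True), (x, False), (y, False)] \<in> raag_relators G"
    using assms xy by (auto simp: raag_relators_def)
  from pres_cong.relator[OF _ _ this, of "[]" "verts G" "[]"]
  have "?c [(x, True), (y, True), (x, False), (y, False)] = ?c []"
    using xy by (simp add: pres_class_eq_iff)
  then have "raag_gen G x \<otimes>\<^bsub>raag G\<^esub> (raag_gen G y \<otimes>\<^bsub>raag G\<^esub>
      (inv\<^bsub>raag G\<^esub> raag_gen G x \<otimes>\<^bsub>raag G\<^esub> inv\<^bsub>raag G\<^esub> raag_gen G y)) = \<one>\<^bsub>raag G\<^esub>"
    using xy magnus.inv_letter[unfolded magnus_group]
      mult_presented_group[OF magnus.relators, unfolded magnus_group]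
      one_presented_group[of "verts G" "raag_relators G", unfolded magnus_group]
    by (simp add: raag_gen_def)
  then have "raag_gen G x \<otimes>\<^bsub>raag G\<^esub> raag_gen G y \<otimes>\<^bsub>raag G\<^esub>
      inv\<^bsub>raag G\<^esub> (raag_gen G y \<otimes>\<^bsub>raag G\<^esub> raag_gen G x) = \<one>\<^bsub>raag G\<^esub>"
    using xy raag_gen_closed by (simp add: A.inv_mult_group A.m_assoc)
  then show ?thesis
    using xy raag_gen_closed A.inv_equality by (metis A.inv_inv A.inv_closed A.m_closed)
qed

lemma syllable_commute:
  assumes "adj x y"
  shows "raag_gen G x [^]\<^bsub>raag G\<^esub> (d :: int) \<otimes>\<^bsub>raag G\<^esub> raag_gen G y [^]\<^bsub>raag G\<^esub> (e :: int) =
    raag_gen G y [^]\<^bsub>raag G\<^esub> e \<otimes>\<^bsub>raag G\<^esub> raag_gen G x [^]\<^bsub>raag G\<^esub> d"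
proof -
  have xy: "raag_gen G x \<in> carrier (raag G)" "raag_gen G y \<in> carrier (raag G)"
    using assms by (auto simp: arcs_ends_conv intro: raag_gen_closed)
  show ?thesis
    using A.int_pow_commute A.int_pow_commute[OF raag_gen_commute[OF assms] xy, of d] xy by simp
qed

text \<open>The new syllable moves right past neighbours of \<open>x\<close> to the first
  \<open>x\<close>-syllable and is absorbed there; if the exponents cancel, that syllable
  disappears. The last clause strengthens the induction: it keeps the word square-free in front of
  the syllables that were passed.\<close>

lemma merge_syllable:
  assumes "x \<in> verts G" "can_lead adj x (map fst s)" "fst ` set s \<subseteq> verts G"
    "square_free adj (map fst s)" "0 \<notin> snd ` set s"
  shows "\<exists>s'. length s' \<le> length s \<and> fst ` set s' \<subseteq> verts G \<and>
    square_free adj (map fst s') \<and> 0 \<notin> snd ` set s' \<and>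
    syllables s' = (raag_gen G x [^]\<^bsub>raag G\<^esub> (d :: int)) \<otimes>\<^bsub>raag G\<^esub> syllables s \<and>
    (\<forall>y. adj y x \<longrightarrow> can_lead adj y (map fst s') = can_lead adj y (map fst s))"
  using assms(2-)
proof (induction s)
  case (Cons c t)
  obtain y e where c: "c = (y, e)" by fastforce
  have t: "fst ` set t \<subseteq> verts G" "square_free adj (map fst t)" "0 \<notin> snd ` set t"
    "\<not> can_lead adj y (map fst t)" and ye: "y \<in> verts G" "e \<noteq> 0"
    using Cons.prems by (auto simp: c)
  have closed: "raag_gen G x \<in> carrier (raag G)" "raag_gen G y \<in> carrier (raag G)"
      "syllables t \<in> carrier (raag G)"
    using assms(1) ye t raag_gen_closed syllables_closed by auto
  show ?case
  proof (cases "y = x")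
    case True
    have eq: "raag_gen G x [^]\<^bsub>raag G\<^esub> d \<otimes>\<^bsub>raag G\<^esub> syllables (c # t) =
        raag_gen G x [^]\<^bsub>raag G\<^esub> (d + e) \<otimes>\<^bsub>raag G\<^esub> syllables t"
      using closed True by (simp add: c syllables_Cons A.int_pow_mult A.m_assoc)
    \<comment> \<open>If the leading \<open>x\<close>-syllable is deleted, a neighbour
      \<open>z\<close> of \<open>x\<close> can lead as before, because \<open>x\<close> differs from
      \<open>z\<close> and does not block it.\<close>
    have lead: "\<not> adj z x \<or> x \<noteq> z" for z
      using irreflp_adj by (auto simp: irreflp_def)
    show ?thesis
    proof (cases "d + e = 0")
      case d: True
      show ?thesis
        using t closed True d lead eq by (intro exI[of _ t]) (auto simp: c)
    next
      case d: False
      show ?thesis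
        using t closed True d ye eq
        by (intro exI[of _ "(x, d + e) # t"]) (auto simp: c syllables_Cons)
    qed
  next
    case False
    then have xy: "adj x y" and lead: "can_lead adj x (map fst t)"
      using Cons.prems by (auto simp: c)
    from Cons.IH[OF lead t(1-3)] obtain t' where t': "length t' \<le> length t" "fst ` set t' \<subseteq> verts G"
      "square_free adj (map fst t')" "0 \<notin> snd ` set t'"
      "syllables t' = raag_gen G x [^]\<^bsub>raag G\<^esub> d \<otimes>\<^bsub>raag G\<^esub> syllables t"
      "\<forall>y. adj y x \<longrightarrow> can_lead adj y (map fst t') = can_lead adj y (map fst t)"
      by blast
    have "syllables ((y, e) # t') = raag_gen G x [^]\<^bsub>raag G\<^esub> d \<otimes>\<^bsub>raag G\<^esub> syllables (c # t)"
      using closed syllable_commute[OF xy, of d e] t'(5)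
      by (simp add: c syllables_Cons flip: A.m_assoc)
    \<comment> \<open>The passed letter \<open>y\<close> is a neighbour of \<open>x\<close>, so the
      strengthened hypothesis transfers this from \<open>t\<close> to \<open>t'\<close>.\<close>
    moreover have "\<not> can_lead adj y (map fst t')"
      using t'(6) t(4) sympD[OF symp_adj xy] by blast
    ultimately show ?thesis
      using t' ye by (intro exI[of _ "(y, e) # t'"]) (auto simp: c)
  qed
qed simp

lemma prepend_syllable:
  assumes "x \<in> verts G" "d \<noteq> 0" "fst ` set s \<subseteq> verts G"
    "square_free adj (map fst s)" "0 \<notin> snd ` set s"
  shows "\<exists>s'. length s' \<le> Suc (length s) \<and> fst ` set s' \<subseteq> verts G \<and>
    square_free adj (map fst s') \<and> 0 \<notin> snd ` set s' \<and>
    syllables s' = (raag_gen G x [^]\<^bsub>raag G\<^esub> (d :: int)) \<otimes>\<^bsub>raag G\<^esub> syllables s"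
proof (cases "can_lead adj x (map fst s)")
  case True
  from merge_syllable[OF assms(1) True assms(3-)] show ?thesis
    by (meson le_SucI)
next
  case False
  then show ?thesis
    using assms by (intro exI[of _ "(x, d) # s"]) (auto simp: syllables_Cons)
qed

text \<open>Letters are prepended one at a time, each adding at most one syllable. The resulting
  length bound is what links word norm to Magnus depth.\<close>

lemma ex_syllables:
  assumes "set ws \<subseteq> raag_gen G ` verts G \<union> m_inv (raag G) ` raag_gen G ` verts G"
  shows "\<exists>s. length s \<le> length ws \<and> fst ` set s \<subseteq> verts G \<and> square_free adj (map fst s) \<and>
    0 \<notin> snd ` set s \<and> syllables s = foldr (monoid.mult (raag G)) ws \<one>\<^bsub>raag G\<^esub>"
  using assms
proof (induction ws)
  case Nil
  then show ?case
    by (intro exI[of _ "[]"]) (simp add: syllables_Nil)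
next
  case (Cons a ws)
  then obtain s where s: "length s \<le> length ws" "fst ` set s \<subseteq> verts G"
      "square_free adj (map fst s)" "0 \<notin> snd ` set s"
      "syllables s = foldr (monoid.mult (raag G)) ws \<one>\<^bsub>raag G\<^esub>"
    by auto
  obtain x d where x: "x \<in> verts G" "d \<noteq> 0" "a = raag_gen G x [^]\<^bsub>raag G\<^esub> (d :: int)"
  proof -
    from Cons.prems obtain x where x: "x \<in> verts G"
        "a = raag_gen G x \<or> a = inv\<^bsub>raag G\<^esub> raag_gen G x"
      by auto
    then have "a = raag_gen G x [^]\<^bsub>raag G\<^esub> (1 :: int) \<or> a = raag_gen G x [^]\<^bsub>raag G\<^esub> (- 1 :: int)"
      using raag_gen_closed by (auto simp: A.int_pow_neg)
    then show thesis
      using that[OF x(1), of 1] that[OF x(1), of "- 1"] by auto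
  qed
  obtain s' where s': "length s' \<le> Suc (length s)" "fst ` set s' \<subseteq> verts G"
      "square_free adj (map fst s')" "0 \<notin> snd ` set s'" "syllables s' = a \<otimes>\<^bsub>raag G\<^esub> syllables s"
    using prepend_syllable[OF x(1,2) s(2-4)] x(3) by blast
  from s' s(1,5) show ?case
    by (intro exI[of _ s']) simp
qed

section \<open>Comparison of word length with Magnus depth\<close>

text \<open>The indicator of the normal form of \<open>w\<close> is evaluated at the empty word
  after acting by \<open>w\<close>. The depth of \<open>w\<close> forces the value 0 if the word is
  too short, whereas the expansion yields the product of the nonzero exponents.\<close>

lemma lower_central_length_ge:
  assumes w: "w \<in> lower_central (raag G) (Suc k)" "w \<noteq> \<one>\<^bsub>raag G\<^esub>"
    and ws: "set ws \<subseteq> raag_gen G ` verts G \<union> m_inv (raag G) ` raag_gen G ` verts G"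
      "foldr (monoid.mult (raag G)) ws \<one>\<^bsub>raag G\<^esub> = w"
  shows "Suc k \<le> length ws"
proof (rule ccontr)
  assume less: "\<not> Suc k \<le> length ws"
  obtain s where s: "length s \<le> length ws" "fst ` set s \<subseteq> verts G"
      "square_free adj (map fst s)" "0 \<notin> snd ` set s" "syllables s = w"
    using ex_syllables[OF ws(1)] ws(2) by blast
  let ?f = "trace_indicator adj (map fst s)"
  have f: "?f \<in> trace_funs adj (Suc (length s))"
    using trace_indicator_in_trace_funs[OF symp_adj irreflp_adj s(3)] by simp
  have f0: "?f v = 0" if "length v \<noteq> length s" for v
    using that length_swaps[of adj "map fst s" v] by (auto simp: trace_indicator_def)
  have "s \<noteq> []"
    using s(5) w(2) by (auto simp: syllables_Nil)
  have "(\<lambda>v. magnus.act w ?f v - ?f v) \<in> trace_funs adj (Suc (length s) - Suc k)"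
    using w(1) lower_central_subset_magnus_depth f by (blast intro: magnus_depthD)
  \<comment> \<open>As \<open>length s \<le> k\<close>, the truncated difference
    \<open>Suc (length s) - Suc k\<close> is 0, so the function vanishes even at the empty
    word.\<close>
  then have "magnus.act w ?f [] = ?f []"
    using trace_funs_length[of _ adj "Suc (length s) - Suc k" "[]"] less s(1) by fastforce
  also have "\<dots> = 0"
    using \<open>s \<noteq> []\<close> by (intro f0) auto
  finally have "foldr (\<lambda>(x, e). shear e x) s ?f [] = 0"
    using act_syllables[OF s(2) f] s(5) by simp
  then have "prod_list (map snd s) * ?f (map fst s) = 0"
    using foldr_shear_eq_prod[of "length s" ?f "[]" s] f0 by simp
  moreover have "?f (map fst s) = 1"
    by (simp add: trace_indicator_def)
  ultimately show False
    using s(4) by (simp add: prod_list_zero_iff)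
qed

text \<open>Ensures that the \<open>LEAST\<close> in \<open>word_norm\<close> is attained by an
  actual word; otherwise its value would be unspecified.\<close>

lemma ex_word:
  assumes "g \<in> carrier (raag G)"
  shows "\<exists>ws. set ws \<subseteq> raag_gen G ` verts G \<union> m_inv (raag G) ` raag_gen G ` verts G \<and>
    foldr (monoid.mult (raag G)) ws \<one>\<^bsub>raag G\<^esub> = g"
proof -
  obtain u where u: "u \<in> gwords (verts G)" "g = pres_class (verts G) (raag_relators G) u"
    using assms magnus.carrier_classE unfolding magnus_group by blast
  let ?ws = "map (\<lambda>c. pres_class (verts G) (raag_relators G) [c]) u"
  have "pres_class (verts G) (raag_relators G) [c]
      \<in> raag_gen G ` verts G \<union> m_inv (raag G) ` raag_gen G ` verts G" if "c \<in> set u" for c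
  proof -
    have "c \<in> verts G \<times> UNIV"
      using that u(1) by blast
    then obtain x b where "c = (x, b)" "x \<in> verts G"
      by blast
    then show ?thesis
      using magnus.inv_letter[of x, unfolded magnus_group]
      by (cases b) (auto simp: raag_gen_def image_iff)
  qed
  then have "set ?ws \<subseteq> raag_gen G ` verts G \<union> m_inv (raag G) ` raag_gen G ` verts G"
    by auto
  moreover have "foldr (monoid.mult (raag G)) ?ws \<one>\<^bsub>raag G\<^esub> = g"
    using magnus.class_eq_foldr[OF u(1), unfolded magnus_group] u(2) by simp
  ultimately show ?thesis by blast
qed

lemma lower_central_word_norm_ge:
  assumes "w \<in> lower_central (raag G) (Suc k)" "w \<noteq> \<one>\<^bsub>raag G\<^esub>"
  shows "Suc k \<le> word_norm (raag G) (raag_gen G ` verts G) w"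
proof -
  let ?P = "\<lambda>l. \<exists>ws. length ws = l \<and>
    set ws \<subseteq> raag_gen G ` verts G \<union> m_inv (raag G) ` raag_gen G ` verts G \<and>
    foldr (monoid.mult (raag G)) ws \<one>\<^bsub>raag G\<^esub> = w"
  have "w \<in> carrier (raag G)"
    using assms(1) lower_central_subset_magnus_depth magnus_depth_closed by blast
  then have "\<exists>l. ?P l"
    using ex_word by blast
  then have "?P (LEAST l. ?P l)"
    by (rule LeastI_ex)
  then show ?thesis
    using lower_central_length_ge[OF assms] unfolding word_norm_def by force
qed


section \<open>Nontriviality of the lower central series\<close>

lemma lower_central_nontrivial:
  assumes xy: "x \<in> verts G" "y \<in> verts G" "x \<noteq> y" "\<not> adj x y"
  shows "\<exists>c\<in>lower_central (raag G) (Suc k). c \<noteq> \<one>\<^bsub>raag G\<^esub>"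
proof -
  \<comment> \<open>\<open>x\<close> acts on the integers as a reflection, \<open>y\<close> as a translation, all other vertices trivially.\<close>
  define \<phi> :: "'a \<times> bool \<Rightarrow> int \<Rightarrow> int" where
    "\<phi> = (\<lambda>(z, b) n. if z = x then - n else if z = y then (if b then n + 1 else n - 1) else n)"
  interpret D: presentation_action "verts G" "raag_relators G" \<phi> UNIV
  proof
    show "raag_relators G \<subseteq> gwords (verts G)"
      by (rule magnus.relators)
    show "foldr \<phi> r f = f" if "r \<in> raag_relators G" for r f
    proof -
      from that obtain u v where r: "r = [(u, True), (v, True), (u, False), (v, False)]" and E: "adj u v"
        by (auto simp: raag_relators_def)
      \<comment> \<open>Since \<open>x\<close> and \<open>y\<close> are not adjacent, no relator
        contains both, and any other two generators act by commuting maps.\<close>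
      then have "\<not> (u = x \<and> v = y)" "\<not> (u = y \<and> v = x)" "u \<noteq> v"
        using xy sympD[OF symp_adj E] irreflp_adj by (auto simp: irreflp_def)
      then show ?thesis by (auto simp: r \<phi>_def)
    qed
  qed (auto simp: \<phi>_def)
  note D_mult = D.act_mult[unfolded magnus_group, OF _ _ UNIV_I]
  note D_inv = D.act_inv[unfolded magnus_group, OF _ UNIV_I]
  have act_x: "D.act (raag_gen G x) n = - n" and act_y: "D.act (raag_gen G y) n = n + 1" for n
    using D.act_letter[OF xy(1), of n True] D.act_letter[OF xy(2), of n True] xy(3)
    by (simp_all add: raag_gen_def \<phi>_def)
  have "\<exists>c\<in>lower_central (raag G) (Suc k). \<forall>n. D.act c n = n + 2 ^ k"
  proof (induction k)
    case 0
    then show ?case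
      using act_y raag_gen_closed[OF xy(2)] by auto
  next
    case (Suc k)
    then obtain c where c: "c \<in> lower_central (raag G) (Suc k)" "D.act c n = n + 2 ^ k" for n
      by blast
    let ?x = "raag_gen G x"
    \<comment> \<open>Conjugation by the reflection \<open>x\<close> inverts the translation
      \<open>c\<close>, so this commutator acts as the square of \<open>c\<close> and the
      translation length doubles.\<close>
    let ?c = "c \<otimes>\<^bsub>raag G\<^esub> ?x \<otimes>\<^bsub>raag G\<^esub> inv\<^bsub>raag G\<^esub> c \<otimes>\<^bsub>raag G\<^esub> inv\<^bsub>raag G\<^esub> ?x"
    have closed: "c \<in> carrier (raag G)" "?x \<in> carrier (raag G)"
      using c(1) lower_central_subset_magnus_depth magnus_depth_closed raag_gen_closed[OF xy(1)] by blast+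
    have "D.act (inv\<^bsub>raag G\<^esub> c) n = n - 2 ^ k" "D.act (inv\<^bsub>raag G\<^esub> ?x) n = - n" for n
      using D_inv[OF closed(1), of n] D_inv[OF closed(2), of n] by (auto simp: c(2) act_x)
    then have "D.act ?c n = n + 2 ^ Suc k" for n
      using closed by (simp add: D_mult c(2) act_x)
    moreover have "?c \<in> lower_central (raag G) (Suc (Suc k))"
      using c(1) closed(2) by (auto simp: commutator_subgroup_def intro!: generate.incl)
    ultimately show ?case by blast
  qed
  then obtain c where c: "c \<in> lower_central (raag G) (Suc k)" "D.act c 0 = 2 ^ k"
    by fastforce
  moreover have "D.act \<one>\<^bsub>raag G\<^esub> 0 = 0"
    using D.act_one[unfolded magnus_group, of 0] by simp
  ultimately have "c \<noteq> \<one>\<^bsub>raag G\<^esub>" by auto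
  with c(1) show ?thesis by blast
qed

end

theorem theorem2:
  fixes X :: "('a, 'b) pre_digraph" and k :: nat
  assumes "graph X"
    and "\<not> complete_digraph (card (verts X)) X"
    and "k \<ge> 1"
  shows "lcs_depth (raag X) (raag_gen X ` verts X) k \<ge> k \<and>
         (\<forall>w \<in> lower_central (raag X) k. w \<noteq> \<one>\<^bsub>raag X\<^esub> \<longrightarrow>
           word_norm (raag X) (raag_gen X ` verts X) w \<ge> k)"
proof -
  interpret graph X by fact
  from \<open>k \<ge> 1\<close> obtain j where k: "k = Suc j"
    by (cases k) auto
  have ge: "k \<le> word_norm (raag X) (raag_gen X ` verts X) w"
    if "w \<in> lower_central (raag X) k" "w \<noteq> \<one>\<^bsub>raag X\<^esub>" for w
    using that lower_central_word_norm_ge unfolding k by blast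
  \<comment> \<open>Completeness asks for equality here. This inclusion holds in every loop-free
    graph, so a failure of completeness yields a missing pair of distinct vertices.\<close>
  have "arcs_ends X \<subseteq> {(u, v). (u, v) \<in> verts X \<times> verts X \<and> u \<noteq> v}"
    using no_loops by (auto simp: arcs_ends_conv)
  with assms(1,2) obtain x y where "x \<in> verts X" "y \<in> verts X" "x \<noteq> y" "\<not> x \<rightarrow>\<^bsub>X\<^esub> y"
    unfolding complete_digraph_def by blast
  \<comment> \<open>Over the empty set the infimum would be 0; nonemptiness is what permits
    \<open>cINF_greatest\<close>.\<close>
  then have "lower_central (raag X) k - {\<one>\<^bsub>raag X\<^esub>} \<noteq> {}"
    using lower_central_nontrivial[of x y j] unfolding k by blast
  then have "k \<le> lcs_depth (raag X) (raag_gen X ` verts X) k"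
    unfolding lcs_depth_def using ge by (intro cINF_greatest) auto
  with ge show ?thesis by blast
qed

end
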